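(* There is an algorithm which, given a sandpile instance $S(G,\sigma)$ where $G$ is the complete graph (clique) on $n$ vertices, determines whether $S$ terminates and, if so, computes the terminal configuration of $S$ in $O(n)$ time and $O(n)$ memory.
   Context: Sandpile without sinks: $\sigma\in\mathbb{N}^{V(G)}$ gives chip counts; a vertex $v$ is full if $\sigma_v\ge\deg(v)$; firing a full $v$ decreases $\sigma_v$ by $\deg(v)$ and adds one chip to each neighbor; a configuration is terminal if no vertex is full; the instance terminates if some finite sequence of firings reaches a terminal configuration (which is then unique), otherwise it is recurrent. Word-RAM model with $\Theta(\log n)$-bit words. *)

theory Defs
  imports "Graph_Theory.Kuratowski" "HOL-Library.Landau_Symbols"
begin

section \<open>Sandpiles without sinks\<close>

text \<open>
  Undirected graphs are the symmetric digraphs of \<^locale>\<open>graph\<close> (finite, no loops, no parallel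
  arcs), so the degree of a vertex is its out-degree. A configuration is a function on the whole
  vertex type; its values outside \<^term>\<open>verts G\<close> are irrelevant and never change.
\<close>

type_synonym 'a config = "'a \<Rightarrow> nat"

definition full :: "('a,'b) pre_digraph \<Rightarrow> 'a config \<Rightarrow> 'a \<Rightarrow> bool" where
  "full G \<sigma> v \<longleftrightarrow> v \<in> verts G \<and> out_degree G v \<le> \<sigma> v"

definition fire :: "('a,'b) pre_digraph \<Rightarrow> 'a \<Rightarrow> 'a config \<Rightarrow> 'a config" where
  "fire G v \<sigma> = (\<lambda>u. if u = v then \<sigma> u - out_degree G v
                     else if v \<rightarrow>\<^bsub>G\<^esub> u then \<sigma> u + 1
                     else \<sigma> u)"

definition firing :: "('a,'b) pre_digraph \<Rightarrow> 'a config \<Rightarrow> 'a config \<Rightarrow> bool" where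
  "firing G \<sigma> \<tau> \<longleftrightarrow> (\<exists>v. full G \<sigma> v \<and> \<tau> = fire G v \<sigma>)"

definition terminal :: "('a,'b) pre_digraph \<Rightarrow> 'a config \<Rightarrow> bool" where
  "terminal G \<sigma> \<longleftrightarrow> (\<nexists>v. full G \<sigma> v)"

definition terminal_config_of ::
    "('a,'b) pre_digraph \<Rightarrow> 'a config \<Rightarrow> 'a config \<Rightarrow> bool" where
  "terminal_config_of G \<sigma> \<tau> \<longleftrightarrow> (firing G)\<^sup>*\<^sup>* \<sigma> \<tau> \<and> terminal G \<tau>"

definition terminates :: "('a,'b) pre_digraph \<Rightarrow> 'a config \<Rightarrow> bool" where
  "terminates G \<sigma> \<longleftrightarrow> (\<exists>\<tau>. terminal_config_of G \<sigma> \<tau>)"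

section \<open>The word-RAM\<close>

text \<open>
  The word length \<open>w\<close> varies with the input size, so words are the natural numbers below \<open>2 ^ w\<close>
  rather than elements of a fixed-length word type. A program is a finite list of instructions and
  hence mentions only finitely many registers. The memory is addressed by words.
\<close>

datatype binop = ADD | SUB | MUL | DIV | MOD | AND | OR | XOR | SHL | SHR

datatype instr =
    LoadImm nat nat        \<comment> \<open>\<open>LoadImm d k\<close>: register \<open>d\<close> gets the constant \<open>k\<close>\<close>
  | Arith binop nat nat nat \<comment> \<open>\<open>Arith f d a b\<close>: register \<open>d\<close> gets \<open>f\<close> of registers \<open>a\<close>, \<open>b\<close>\<close>
  | Load nat nat           \<comment> \<open>\<open>Load d a\<close>: register \<open>d\<close> gets the cell addressed by register \<open>a\<close>\<close>
  | Store nat nat          \<comment> \<open>\<open>Store a b\<close>: the cell addressed by register \<open>a\<close> gets register \<open>b\<close>\<close>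
  | Jump nat
  | JumpLess nat nat nat   \<comment> \<open>\<open>JumpLess a b l\<close>: go to \<open>l\<close> if register \<open>a\<close> is below register \<open>b\<close>\<close>
  | JumpEq nat nat nat
  | Halt

type_synonym program = "instr list"

record ram_state =
  pc :: nat
  regs :: "nat \<Rightarrow> nat"
  mem :: "nat \<Rightarrow> nat"

definition arith :: "nat \<Rightarrow> binop \<Rightarrow> nat \<Rightarrow> nat \<Rightarrow> nat" where
  "arith w f x y =
    (case f of
       ADD \<Rightarrow> x + y
     | SUB \<Rightarrow> x + 2 ^ w - y
     | MUL \<Rightarrow> x * y
     | DIV \<Rightarrow> x div y
     | MOD \<Rightarrow> x mod y
     | AND \<Rightarrow> and x y
     | OR \<Rightarrow> or x y
     | XOR \<Rightarrow> xor x y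
     | SHL \<Rightarrow> push_bit y x
     | SHR \<Rightarrow> drop_bit y x) mod 2 ^ w"

fun exec :: "nat \<Rightarrow> instr \<Rightarrow> ram_state \<Rightarrow> ram_state" where
  "exec w (LoadImm d k) s = s\<lparr>pc := pc s + 1, regs := (regs s)(d := k mod 2 ^ w)\<rparr>"
| "exec w (Arith f d a b) s =
     s\<lparr>pc := pc s + 1, regs := (regs s)(d := arith w f (regs s a) (regs s b))\<rparr>"
| "exec w (Load d a) s = s\<lparr>pc := pc s + 1, regs := (regs s)(d := mem s (regs s a))\<rparr>"
| "exec w (Store a b) s = s\<lparr>pc := pc s + 1, mem := (mem s)(regs s a := regs s b)\<rparr>"
| "exec w (Jump l) s = s\<lparr>pc := l\<rparr>"
| "exec w (JumpLess a b l) s = s\<lparr>pc := (if regs s a < regs s b then l else pc s + 1)\<rparr>"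
| "exec w (JumpEq a b l) s = s\<lparr>pc := (if regs s a = regs s b then l else pc s + 1)\<rparr>"
| "exec w Halt s = s"

definition current :: "program \<Rightarrow> ram_state \<Rightarrow> instr" where
  "current P s = (if pc s < length P then P ! pc s else Halt)"

definition step :: "nat \<Rightarrow> program \<Rightarrow> ram_state \<Rightarrow> ram_state" where
  "step w P s = exec w (current P s) s"

fun accessed :: "instr \<Rightarrow> ram_state \<Rightarrow> nat set" where
  "accessed (Load d a) s = {regs s a}"
| "accessed (Store a b) s = {regs s a}"
| "accessed _ s = {}"

text \<open>
  From state \<open>s\<close>, the program halts in state \<open>s'\<close> after at most \<open>T\<close> instructions, each of unit
  cost, and only ever touches the first \<open>S\<close> memory cells.
\<close>

definition halts_within ::
    "nat \<Rightarrow> program \<Rightarrow> ram_state \<Rightarrow> nat \<Rightarrow> nat \<Rightarrow> ram_state \<Rightarrow> bool" where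
  "halts_within w P s T S s' \<longleftrightarrow>
    (\<exists>t\<le>T. s' = (step w P ^^ t) s \<and> current P s' = Halt \<and>
       (\<forall>i<t. \<forall>a \<in> accessed (current P ((step w P ^^ i) s)) ((step w P ^^ i) s). a < S))"

section \<open>Input and output convention\<close>

text \<open>
  A clique is determined by its number of vertices, so the instance with vertices \<open>0, \<dots>, n - 1\<close>
  is given by \<open>n\<close> in register 0 and the chip counts in the first \<open>n\<close> memory cells. An explicit list
  of edges could not even be read in time linear in \<open>n\<close>.
\<close>

definition input_state :: "nat \<Rightarrow> nat config \<Rightarrow> ram_state" where
  "input_state n \<sigma> =
    \<lparr>pc = 0, regs = (\<lambda>r. if r = 0 then n else 0), mem = (\<lambda>a. if a < n then \<sigma> a else 0)\<rparr>"

text \<open>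
  Register 0 reports whether the instance terminates; if it does, the first \<open>n\<close> memory cells hold
  the terminal configuration.
\<close>

definition correct_output ::
    "(nat,'b) pre_digraph \<Rightarrow> nat config \<Rightarrow> ram_state \<Rightarrow> bool" where
  "correct_output G \<sigma> s \<longleftrightarrow>
    regs s 0 = (if terminates G \<sigma> then 1 else 0) \<and>
    (\<forall>\<tau>. terminal_config_of G \<sigma> \<tau> \<longrightarrow> (\<forall>v\<in>verts G. mem s v = \<tau> v))"

text \<open>
  Word lengths in \<open>\<Theta>(log n)\<close>. The second condition makes \<open>c * n\<close> memory cells addressable; it is
  needed because a word of \<open>\<epsilon> log n\<close> bits with \<open>\<epsilon> < 1\<close> cannot even store the index of a vertex.
\<close>

definition logarithmic_word_length :: "nat \<Rightarrow> (nat \<Rightarrow> nat) \<Rightarrow> bool" where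
  "logarithmic_word_length c w \<longleftrightarrow>
    (\<lambda>n. real (w n)) \<in> \<Theta>(\<lambda>n. ln (real n)) \<and> (\<forall>n\<ge>1. c * n < 2 ^ w n)"

end

theory Submission
  imports Defs
begin

text \<open>
  After \<open>k\<close> firings on the clique, a vertex that fired \<open>f v\<close> times holds \<open>\<sigma> v + k - n * f v\<close>
  chips. So once \<open>k\<close> firings have taken place, exhausting \<open>v\<close> means that it has fired
  \<open>(\<sigma> v + k + 1) div n\<close> times, and the instance terminates iff the sum of these numbers is at
  most \<open>k\<close> for some \<open>k\<close>. Raising \<open>k\<close> by \<open>n\<close> raises the sum by \<open>n\<close>, so only \<open>k < n\<close> matter;
  for the least such \<open>k\<close>, the terminal configuration is \<open>(\<sigma> v + k) mod n\<close>. Raising \<open>k\<close> to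
  \<open>k + 1\<close> increases the sum by the number of vertices with a particular residue modulo \<open>n\<close>, so
  counting residues once makes all \<open>n\<close> tests possible in linear time.
\<close>

section \<open>Sandpiles on a clique\<close>

lemma out_degree_complete_digraph:
  assumes "complete_digraph n G" "v \<in> verts G"
  shows "out_degree G v = n - 1"
proof -
  interpret graph G using assms by (simp add: complete_digraph_def)
  have ends: "arcs_ends G = {(u, v). (u, v) \<in> verts G \<times> verts G \<and> u \<noteq> v}"
    and card: "card (verts G) = n"
    using assms by (auto simp: complete_digraph_def)
  have "inj_on (arc_to_ends G) (out_arcs G v)"
    by (intro inj_onI no_multi_arcs) auto
  then have "out_degree G v = card (arc_to_ends G ` out_arcs G v)"
    by (simp add: out_degree_def card_image)
  also have "arc_to_ends G ` out_arcs G v = {e \<in> arcs_ends G. fst e = v}"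
    by (auto simp: arcs_ends_def arc_to_ends_def)
  also have "\<dots> = Pair v ` (verts G - {v})"
    using assms(2) unfolding ends by auto
  also have "card \<dots> = n - 1"
    using assms(2) card by (simp add: card_image inj_on_def)
  finally show ?thesis .
qed

text \<open>The degree is \<open>card V - 1\<close>, so a vertex with \<open>x\<close> chips is full
  iff \<open>x + 1 \<ge> card V\<close>. Hence the argument used below is \<open>Suc k\<close> when
  \<open>k\<close> firings have taken place.\<close>

definition clique_firings :: "'a set \<Rightarrow> 'a config \<Rightarrow> nat \<Rightarrow> nat" where
  "clique_firings V \<sigma> k = (\<Sum>v\<in>V. (\<sigma> v + k) div card V)"

lemma clique_firings_add_card:
  assumes "finite V" "V \<noteq> {}"
  shows "clique_firings V \<sigma> (k + card V) = clique_firings V \<sigma> k + card V"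
proof -
  have "card V > 0" using assms by (simp add: card_gt_0_iff)
  then have "(\<sigma> v + (k + card V)) div card V = (\<sigma> v + k) div card V + 1" for v
    by (simp add: add.assoc[symmetric] div_add_self2)
  then show ?thesis by (simp add: clique_firings_def sum.distrib sum_Suc)
qed

lemma clique_firings_le_below_card:
  assumes "finite V" "V \<noteq> {}" "clique_firings V \<sigma> (Suc k) \<le> k"
  shows "\<exists>k<card V. clique_firings V \<sigma> (Suc k) \<le> k"
  using assms(3)
proof (induction k rule: less_induct)
  case (less k)
  have "card V > 0" using assms by (simp add: card_gt_0_iff)
  show ?case
  proof (cases "k < card V")
    case False
    then have "clique_firings V \<sigma> (Suc k) = clique_firings V \<sigma> (Suc (k - card V)) + card V"
      using clique_firings_add_card[OF assms(1,2), of \<sigma> "Suc (k - card V)"] by simp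
    then show ?thesis using less False \<open>card V > 0\<close> by (intro less.IH[of "k - card V"]) auto
  qed (use less in auto)
qed

text \<open>
  On a clique, firing \<open>v\<close> amounts to adding one chip everywhere and then removing \<open>n\<close> chips
  from \<open>v\<close>. The second conclusion is the least action principle.
\<close>

lemma clique_firing_counts:
  assumes G: "complete_digraph n G" and run: "(firing G ^^ m) \<sigma> \<tau>"
  obtains f where "sum f (verts G) = m" "\<And>v. v \<in> verts G \<Longrightarrow> \<tau> v + n * f v = \<sigma> v + m"
    "\<And>K v. clique_firings (verts G) \<sigma> (Suc K) \<le> K \<Longrightarrow> v \<in> verts G \<Longrightarrow> f v \<le> (\<sigma> v + Suc K) div n"
proof -
  interpret graph G using G by (simp add: complete_digraph_def)
  have card: "card (verts G) = n"
    and dom: "u \<rightarrow>\<^bsub>G\<^esub> v \<longleftrightarrow> u \<in> verts G \<and> v \<in> verts G \<and> u \<noteq> v" for u v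
    using G by (auto simp: complete_digraph_def)
  have "\<exists>f. sum f (verts G) = m \<and> (\<forall>v\<in>verts G. \<tau> v + n * f v = \<sigma> v + m) \<and>
    (\<forall>K. clique_firings (verts G) \<sigma> (Suc K) \<le> K \<longrightarrow> (\<forall>v\<in>verts G. f v \<le> (\<sigma> v + Suc K) div n))"
    using run
  proof (induction m arbitrary: \<tau>)
    case 0
    then show ?case by (intro exI[of _ "\<lambda>_. 0"]) auto
  next
    case (Suc m)
    from Suc.prems obtain \<rho> where \<rho>: "(firing G ^^ m) \<sigma> \<rho>" and "firing G \<rho> \<tau>"
      by auto
    then obtain x where full: "full G \<rho> x" and \<tau>: "\<tau> = fire G x \<rho>"
      by (auto simp: firing_def)
    from Suc.IH[OF \<rho>] obtain f where f: "sum f (verts G) = m"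
      "\<And>v. v \<in> verts G \<Longrightarrow> \<rho> v + n * f v = \<sigma> v + m"
      "\<And>K v. clique_firings (verts G) \<sigma> (Suc K) \<le> K \<Longrightarrow> v \<in> verts G \<Longrightarrow> f v \<le> (\<sigma> v + Suc K) div n"
      by blast
    have x: "x \<in> verts G" and deg: "out_degree G x = n - 1" and \<rho>x: "n - 1 \<le> \<rho> x"
      using full out_degree_complete_digraph[OF G] by (auto simp: full_def)
    have n: "n > 0" using x card card_gt_0_iff finite_verts by blast
    define g where "g = f(x := Suc (f x))"
    have "sum g (verts G) = Suc (f x) + sum f (verts G - {x})"
      unfolding g_def using x finite_verts by (simp add: sum.remove)
    also have "\<dots> = Suc m"
      using x finite_verts f(1) by (simp add: sum.remove)
    finally have "sum g (verts G) = Suc m" .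
    moreover have "\<tau> v + n * g v = \<sigma> v + Suc m" if "v \<in> verts G" for v
      using f(2)[OF that] x that \<rho>x n by (auto simp: \<tau> fire_def deg dom g_def)
    moreover have "g v \<le> (\<sigma> v + Suc K) div n"
      if K: "clique_firings (verts G) \<sigma> (Suc K) \<le> K" and v: "v \<in> verts G" for K v
    proof (cases "v = x")
      case True
      \<comment> \<open>The bounds on \<open>f\<close> sum to \<open>m \<le> K\<close>; fullness of
        \<open>x\<close> and the balance equation give
        \<open>n * Suc (f x) \<le> \<sigma> x + Suc m\<close>.\<close>
      have "m \<le> clique_firings (verts G) \<sigma> (Suc K)"
        unfolding clique_firings_def card f(1)[symmetric] by (intro sum_mono f(3) K)
      then have "n * Suc (f x) \<le> \<sigma> x + Suc K"
        using f(2)[OF x] \<rho>x K n by simp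
      then show ?thesis
        using True n by (simp add: g_def less_eq_div_iff_mult_less_eq mult.commute)
    next
      case False
      then show ?thesis using f(3)[OF K v] by (simp add: g_def)
    qed
    ultimately show ?case by blast
  qed
  then obtain f where "sum f (verts G) = m" "\<forall>v\<in>verts G. \<tau> v + n * f v = \<sigma> v + m"
    "\<forall>K. clique_firings (verts G) \<sigma> (Suc K) \<le> K \<longrightarrow> (\<forall>v\<in>verts G. f v \<le> (\<sigma> v + Suc K) div n)"
    by (elim exE conjE)
  then show thesis by (intro that[of f]) simp_all
qed

section \<open>Terminal configurations and the termination criterion\<close>

text \<open>At a terminal configuration after \<open>m\<close> firings, \<open>f v\<close> is
  exactly \<open>(\<sigma> v + Suc m) div n\<close>, so \<open>m\<close> passes the test and
  \<open>K \<le> m\<close>; least action gives \<open>m \<le> K\<close>. Thus \<open>m\<close> and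
  the terminal configuration are unique.\<close>

lemma clique_terminal_config:
  assumes G: "complete_digraph n G" and n: "n > 0" and \<tau>: "terminal_config_of G \<sigma> \<tau>"
  defines "K \<equiv> LEAST k. clique_firings (verts G) \<sigma> (Suc k) \<le> k"
  shows "clique_firings (verts G) \<sigma> (Suc K) \<le> K"
    and "\<And>v. v \<in> verts G \<Longrightarrow> \<tau> v = (\<sigma> v + K) mod n"
proof -
  have card: "card (verts G) = n" using G by (simp add: complete_digraph_def)
  obtain m where "(firing G ^^ m) \<sigma> \<tau>"
    using \<tau> by (auto simp: terminal_config_of_def dest: rtranclp_imp_relpowp)
  then obtain f where f: "sum f (verts G) = m"
    "\<And>v. v \<in> verts G \<Longrightarrow> \<tau> v + n * f v = \<sigma> v + m"
    "\<And>K v. clique_firings (verts G) \<sigma> (Suc K) \<le> K \<Longrightarrow> v \<in> verts G \<Longrightarrow> f v \<le> (\<sigma> v + Suc K) div n"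
    using clique_firing_counts[OF G] by metis
  have less: "Suc (\<tau> v) < n" if "v \<in> verts G" for v
    using \<tau> that out_degree_complete_digraph[OF G that]
    by (force simp: terminal_config_of_def terminal_def full_def)
  have "(\<sigma> v + Suc m) div n = f v" if "v \<in> verts G" for v
  proof -
    \<comment> \<open>Terminality means \<open>\<tau> v < n - 1\<close>, so
      \<open>Suc (\<tau> v)\<close> is still a remainder modulo \<open>n\<close>.\<close>
    have "\<sigma> v + Suc m = Suc (\<tau> v) + n * f v" using f(2)[OF that] by simp
    also have "\<dots> div n = f v" using less[OF that] n by (subst div_mult_self2) auto
    finally show ?thesis .
  qed
  then have m: "clique_firings (verts G) \<sigma> (Suc m) = m"
    using f(1) by (simp add: clique_firings_def card)
  then show K: "clique_firings (verts G) \<sigma> (Suc K) \<le> K"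
    unfolding K_def by (metis (mono_tags, lifting) LeastI order_refl)
  have "K \<le> m" unfolding K_def using m by (intro Least_le) simp
  moreover have "m \<le> clique_firings (verts G) \<sigma> (Suc K)"
    unfolding clique_firings_def card f(1)[symmetric] by (intro sum_mono f(3) K)
  ultimately have "m = K" using K by simp
  then show "\<tau> v = (\<sigma> v + K) mod n" if "v \<in> verts G" for v
    using f(2)[OF that, symmetric] less[OF that] by simp
qed

text \<open>Least action bounds the length of every run by any \<open>K\<close> passing the test,
  whereas a recurrent instance has runs of every length.\<close>

lemma clique_terminates_iff:
  assumes G: "complete_digraph n G" and n: "n > 0"
  shows "terminates G \<sigma> \<longleftrightarrow> (\<exists>k<n. clique_firings (verts G) \<sigma> (Suc k) \<le> k)"
proof
  have card: "card (verts G) = n" using G by (simp add: complete_digraph_def)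
  then have V: "finite (verts G)" "verts G \<noteq> {}" using n by (auto simp: card_gt_0_iff)
  assume "terminates G \<sigma>"
  then obtain \<tau> where "terminal_config_of G \<sigma> \<tau>" by (auto simp: terminates_def)
  from clique_firings_le_below_card[OF V clique_terminal_config(1)[OF G n this]]
  show "\<exists>k<n. clique_firings (verts G) \<sigma> (Suc k) \<le> k" by (simp add: card)
next
  assume "\<exists>k<n. clique_firings (verts G) \<sigma> (Suc k) \<le> k"
  then obtain K where K: "clique_firings (verts G) \<sigma> (Suc K) \<le> K" by blast
  have card: "card (verts G) = n" using G by (simp add: complete_digraph_def)
  have bound: "m \<le> K" if run: "(firing G ^^ m) \<sigma> \<tau>" for m \<tau>
  proof -
    obtain f where f: "sum f (verts G) = m"
      "\<And>v. v \<in> verts G \<Longrightarrow> f v \<le> (\<sigma> v + Suc K) div n"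
      using clique_firing_counts[OF G run] K by metis
    have "m \<le> clique_firings (verts G) \<sigma> (Suc K)"
      unfolding clique_firings_def card f(1)[symmetric] by (intro sum_mono f(2))
    then show ?thesis using K by simp
  qed
  show "terminates G \<sigma>"
  proof (rule ccontr)
    assume "\<not> terminates G \<sigma>"
    then have progress: "\<exists>\<rho>. firing G \<tau> \<rho>" if "(firing G)\<^sup>*\<^sup>* \<sigma> \<tau>" for \<tau>
      using that by (auto simp: terminates_def terminal_config_of_def terminal_def firing_def)
    have "\<exists>\<tau>. (firing G ^^ m) \<sigma> \<tau>" for m
    proof (induction m)
      case (Suc m)
      then obtain \<tau> where "(firing G ^^ m) \<sigma> \<tau>" by blast
      then show ?case using progress[of \<tau>] by (auto simp: relpowp_imp_rtranclp)
    qed auto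
    then show False using bound[of "Suc K"] by fastforce
  qed
qed

section \<open>Increments of the firing count\<close>

lemma clique_firings_mono: "j \<le> k \<Longrightarrow> clique_firings V \<sigma> j \<le> clique_firings V \<sigma> k"
  unfolding clique_firings_def by (intro sum_mono div_le_mono) simp

text \<open>For \<open>n > 0\<close>, \<open>x mod n + j\<close> is below \<open>2 * n\<close>, so
  at most one carry occurs. For \<open>n = 0\<close> both quotients are 0, hence the guard.\<close>

lemma add_div_eq_if:
  fixes x n j :: nat
  assumes "j \<le> n"
  shows "(x + j) div n = x div n + (if 0 < n \<and> n \<le> x mod n + j then 1 else 0)"
proof (cases "n = 0")
  case False
  then have less: "x mod n < n" by simp
  have "x + j = x mod n + j + n * (x div n)" by simp
  also have "\<dots> div n = x div n + (x mod n + j) div n"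
    using False by (subst div_mult_self2) auto
  also have "(x mod n + j) div n = (if n \<le> x mod n + j then 1 else 0)"
  proof (cases "n \<le> x mod n + j")
    case True
    then have "(x mod n + j) div n = 1" using assms less by (intro div_nat_eqI) auto
    then show ?thesis using True by simp
  qed simp
  finally show ?thesis using False by simp
qed simp

lemma clique_firings_Suc:
  assumes "k < n"
  shows "clique_firings {..<n} \<sigma> (Suc k) =
    clique_firings {..<n} \<sigma> k + card {v \<in> {..<n}. \<sigma> v mod n = n - Suc k}"
proof -
  \<comment> \<open>Offset \<open>Suc k\<close> carries and offset \<open>k\<close> does not exactly
    when \<open>\<sigma> v mod n + Suc k = n\<close>.\<close>
  have "(\<sigma> v + Suc k) div n = (\<sigma> v + k) div n + (if \<sigma> v mod n = n - Suc k then 1 else 0)" for v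
    using assms by (subst (1 2) add_div_eq_if) (auto split: if_splits)
  then show ?thesis
    by (simp add: clique_firings_def sum.distrib sum.If_cases Int_def)
qed

section \<open>The program\<close>

text \<open>A form of \<open>halts_within\<close> recursive in the time budget, so that rewriting
  can execute programs. An early halt is accepted, so \<open>T\<close> is only an upper
  bound.\<close>

primrec runs_to ::
    "nat \<Rightarrow> program \<Rightarrow> nat \<Rightarrow> nat \<Rightarrow> ram_state \<Rightarrow> (ram_state \<Rightarrow> bool) \<Rightarrow> bool" where
  "runs_to w P S 0 s Q \<longleftrightarrow> current P s = Halt \<and> Q s"
| "runs_to w P S (Suc T) s Q \<longleftrightarrow>
     (if current P s = Halt then Q s
      else accessed (current P s) s \<subseteq> {..<S} \<and> runs_to w P S T (step w P s) Q)"

text \<open>With \<open>T\<close> a variable, rewriting executes a block of fixed length and then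
  stops.\<close>

lemma runs_to_numeral_add:
  "runs_to w P S (numeral k + T) s Q \<longleftrightarrow>
     (if current P s = Halt then Q s
      else accessed (current P s) s \<subseteq> {..<S} \<and> runs_to w P S (pred_numeral k + T) (step w P s) Q)"
  by (simp add: numeral_eq_Suc)

lemma runs_to_halts_within:
  assumes "runs_to w P S T s Q"
  shows "\<exists>s'. halts_within w P s T S s' \<and> Q s'"
  using assms
proof (induction T arbitrary: s)
  case (Suc T)
  show ?case
  proof (cases "current P s = Halt")
    case True
    then show ?thesis
      using Suc.prems by (auto simp: halts_within_def intro!: exI[of _ s] exI[of _ 0])
  next
    case False
    then obtain s' t where Q: "Q s'" and t: "t \<le> T" "s' = (step w P ^^ t) (step w P s)" "current P s' = Halt"
      "\<And>i a. i < t \<Longrightarrow> a \<in> accessed (current P ((step w P ^^ i) (step w P s))) ((step w P ^^ i) (step w P s))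
        \<Longrightarrow> a < S"
      using Suc.prems Suc.IH[of "step w P s"] by (auto simp: halts_within_def)
    have "a < S" if "i < Suc t" "a \<in> accessed (current P ((step w P ^^ i) s)) ((step w P ^^ i) s)" for i a
      using that t(4)[of "i - 1" a] Suc.prems False by (cases i) (auto simp: funpow_swap1)
    then have "halts_within w P s (Suc T) S s'"
      unfolding halts_within_def using t(1-3) by (intro exI[of _ "Suc t"]) (auto simp: funpow_swap1)
    then show ?thesis using Q by blast
  qed
qed (auto simp: halts_within_def)

text \<open>
  Register 0 holds \<open>n\<close>, register 2 the running value of \<^const>\<open>clique_firings\<close>, register 3 the
  constant 1, and register 9 stays 0. The loop at 1 collects the quotients \<open>\<sigma> v div n\<close> and counts
  the residues \<open>\<sigma> v mod n = r\<close> in cell \<open>n + r\<close>; it rejects before the sum of the quotients can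
  overflow. The loop at 17 looks for the least \<open>k\<close> with \<open>clique_firings {..<n} \<sigma> (Suc k) \<le> k\<close>,
  kept in register 8. The loop at 25 writes the terminal configuration.
\<close>

definition clique_program :: program where
  "clique_program =
    [LoadImm 3 1,
     JumpEq 1 0 16,
     Load 4 1,
     Arith DIV 5 4 0,
     JumpLess 5 0 6,
     Jump 14,
     Arith ADD 2 2 5,
     Arith MOD 6 4 0,
     Arith ADD 6 6 0,
     Load 7 6,
     Arith ADD 7 7 3,
     Store 6 7,
     Arith ADD 1 1 3,
     JumpLess 2 0 1,
     LoadImm 0 0,
     Halt,
     Arith ADD 6 0 0,
     JumpEq 8 0 14,
     Arith SUB 6 6 3,
     Load 7 6,
     Arith ADD 2 2 7,
     JumpLess 8 2 23,
     Jump 25,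
     Arith ADD 8 8 3,
     Jump 17,
     JumpEq 1 9 33,
     Arith SUB 1 1 3,
     Load 4 1,
     Arith MOD 4 4 0,
     Arith ADD 4 4 8,
     Arith MOD 4 4 0,
     Store 1 4,
     Jump 25,
     LoadImm 0 1,
     Halt]"

lemma current_clique_program:
  "current clique_program s = (if pc s < 35 then clique_program ! pc s else Halt)"
  by (simp add: current_def clique_program_def)

lemmas nth_clique_program = arg_cong[OF clique_program_def, of "\<lambda>P. P ! p" for p]

lemma arith_SUB: "y \<le> x \<Longrightarrow> x < 2 ^ w \<Longrightarrow> arith w SUB x y = x - y"
  by (metis (no_types, lifting) arith_def binop.case(2) add_diff_assoc2 mod_add_self2 mod_less
      less_imp_diff_less)

section \<open>Correctness and cost of the program\<close>

text \<open>Cells below \<open>n\<close> hold the chips and later the result, the next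
  \<open>n\<close> cells the residue counts. With \<open>2 * n\<close> representable, no address and
  no sum wraps around.\<close>

locale clique_run =
  fixes n w S :: nat and \<sigma> :: "nat config"
  assumes n_pos: "n > 0"
    and addressable: "2 * n < 2 ^ w"
    and chips: "v < n \<Longrightarrow> \<sigma> v < 2 ^ w"
    and space: "2 * n \<le> S"
begin

abbreviation firings :: "nat \<Rightarrow> nat" where
  "firings \<equiv> clique_firings {..<n} \<sigma>"

text \<open>A purely arithmetic output condition, which keeps graphs out of the program
  analysis.\<close>

definition solved :: "ram_state \<Rightarrow> bool" where
  "solved s \<longleftrightarrow>
    (if \<exists>k<n. firings (Suc k) \<le> k
     then regs s 0 = 1 \<and> (\<forall>v<n. mem s v = (\<sigma> v + (LEAST k. firings (Suc k) \<le> k)) mod n)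
     else regs s 0 = 0)"

abbreviation run :: "nat \<Rightarrow> nat \<Rightarrow> (nat \<Rightarrow> nat) \<Rightarrow> (nat \<Rightarrow> nat) \<Rightarrow> bool" where
  "run T p R M \<equiv> runs_to w clique_program S T \<lparr>pc = p, regs = R, mem = M\<rparr> solved"

text \<open>Keeps the constant 1 from being reduced to 0.\<close>

lemma w_pos [simp]: "w > 0"
  using n_pos addressable by (cases w) auto

lemma mod_word: "x < 2 * n \<Longrightarrow> x mod 2 ^ w = x"
  using addressable by simp

lemmas run_simps = runs_to_numeral_add step_def current_clique_program nth_clique_program

lemma run_reject:
  assumes "\<And>k. k < n \<Longrightarrow> k < firings (Suc k)" "2 \<le> T"
  shows "run T 14 R M"
proof -
  obtain T' where "T = 2 + T'" using assms(2) by (auto dest: le_Suc_ex)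
  moreover
  have "\<not> (\<exists>k<n. firings (Suc k) \<le> k)" using assms(1) not_le by blast
  ultimately show ?thesis by (simp add: run_simps solved_def)
qed

text \<open>The overwriting is in place, from the top down: cells from \<open>i\<close> on are
  final, those below still hold input. A round costs 8 instructions, the exit at most 3.\<close>

lemma run_write:
  assumes "K < n" "firings (Suc K) \<le> K" "K = (LEAST k. firings (Suc k) \<le> k)"
    and "R 0 = n" "R 1 = i" "R 3 = 1" "R 8 = K" "R 9 = 0" "i \<le> n"
    and "\<And>v. v < i \<Longrightarrow> M v = \<sigma> v"
    and "\<And>v. i \<le> v \<Longrightarrow> v < n \<Longrightarrow> M v = (\<sigma> v + K) mod n"
    and "8 * i + 3 \<le> T"
  shows "run T 25 R M"
  using assms(4-)
proof (induction i arbitrary: R M T)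
  case 0
  then obtain T' where "T = 3 + T'" by (auto dest: le_Suc_ex)
  moreover have "solved \<lparr>pc = 34, regs = R(0 := Suc 0), mem = M\<rparr>"
    using 0 assms(1-3) by (auto simp: solved_def)
  ultimately show ?case using 0 by (simp add: run_simps)
next
  case (Suc i)
  have i: "i < n" "i < S" using Suc.prems space by auto
  have "8 \<le> T" using Suc.prems by simp
  then obtain T' where T: "T = 8 + T'" by (auto dest: le_Suc_ex)
  have "\<sigma> i mod n < n" using n_pos by simp
  have [simp]: "arith w SUB (Suc i) (Suc 0) = i"
    using i addressable by (subst arith_SUB) auto
  have [simp]: "arith w MOD (\<sigma> i) n = \<sigma> i mod n"
    using n_pos by (simp add: arith_def mod_word trans_less_add1 mult_2)
  \<comment> \<open>Reducing before adding keeps the sum below \<open>2 * n\<close>, hence within a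
    word.\<close>
  have [simp]: "arith w ADD (\<sigma> i mod n) K = \<sigma> i mod n + K"
    unfolding arith_def using add_strict_mono[OF \<open>\<sigma> i mod n < n\<close> assms(1)]
    by (simp add: mod_word)
  have [simp]: "arith w MOD (\<sigma> i mod n + K) n = (\<sigma> i + K) mod n"
    using n_pos by (simp add: arith_def mod_word trans_less_add1 mult_2 mod_add_left_eq)
  have "run T' 25 (R(1 := i, 4 := (\<sigma> i + K) mod n)) (M(i := (\<sigma> i + K) mod n))"
    using Suc.prems T by (intro Suc.IH) auto
  then show ?case
    using Suc.prems i by (simp add: T run_simps)
qed

text \<open>Register 6 is one above the next counter to be read. A round costs 7 instructions;
  \<open>8 * n + 9\<close> pays for the last test and the writing loop.\<close>

lemma run_search:
  assumes "R 0 = n" "R 1 = n" "R 2 = firings k" "R 3 = 1" "R 6 = 2 * n - k" "R 8 = k" "R 9 = 0"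
    and "k \<le> n" "firings 0 < n" "\<And>j. j < k \<Longrightarrow> j < firings (Suc j)"
    and "\<And>v. v < n \<Longrightarrow> M v = \<sigma> v"
    and "\<And>r. r < n \<Longrightarrow> M (n + r) = card {v \<in> {..<n}. \<sigma> v mod n = r}"
    and "7 * (n - k) + 8 * n + 9 \<le> T"
  shows "run T 17 R M"
  using assms
proof (induction "n - k" arbitrary: k R T)
  case 0
  then obtain T' where T: "T = Suc T'" "2 \<le> T'" by (cases T) auto
  then have "run T' 14 R M"
    using 0 by (intro run_reject) auto
  then show ?case using 0 T by (simp add: run_simps)
next
  case (Suc m)
  have k: "k < n" using Suc by simp
  \<comment> \<open>A full period adds only \<open>n\<close> to \<open>firings 0 < n\<close>, so
    register 2 cannot overflow.\<close>
  have "firings (Suc k) \<le> firings (0 + n)"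
    using k by (intro clique_firings_mono) simp
  also have "\<dots> < 2 * n"
    using clique_firings_add_card[of "{..<n}" \<sigma> 0] n_pos \<open>firings 0 < n\<close> by (auto simp: lessThan_empty_iff)
  finally have "firings (Suc k) < 2 ^ w" using addressable by linarith
  moreover have "M (2 * n - Suc k) = card {v \<in> {..<n}. \<sigma> v mod n = n - Suc k}"
    using Suc.prems(12)[of "n - Suc k"] k by (simp add: mult_2)
  ultimately have [simp]: "arith w ADD (firings k) (M (2 * n - Suc k)) = firings (Suc k)"
    using clique_firings_Suc[OF k] by (simp add: arith_def)
  have [simp]: "arith w SUB (2 * n - k) (Suc 0) = 2 * n - Suc k"
    using k addressable by (subst arith_SUB) auto
  have [simp]: "arith w ADD k (Suc 0) = Suc k"
    using k addressable by (simp add: arith_def)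
  have addr: "2 * n - Suc k < S" using k space by linarith
  define R' where "R' = R(6 := 2 * n - Suc k, 7 := M (2 * n - Suc k), 2 := firings (Suc k))"
  have fin: "m = n - Suc k" "n - k = Suc m" using Suc by auto
  show ?case
  proof (cases "k < firings (Suc k)")
    case True
    have "7 \<le> T" using Suc.prems by simp
    then obtain T' where T: "T = 7 + T'" by (auto dest: le_Suc_ex)
    have "run T' 17 (R'(8 := Suc k)) M"
      using Suc.prems k True T by (intro Suc.hyps(1)) (auto simp: R'_def fin less_Suc_eq)
    then show ?thesis
      using True Suc.prems k addr by (simp add: T run_simps R'_def)
  next
    case False
    have "6 \<le> T" using Suc.prems by simp
    then obtain T' where T: "T = 6 + T'" by (auto dest: le_Suc_ex)
    have "k = (LEAST k. firings (Suc k) \<le> k)"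
      using Suc.prems(10) False by (intro Least_equality[symmetric]) (auto simp: not_le[symmetric])
    then have "run T' 25 R' M"
      using False Suc.prems k T by (intro run_write[of k]) (auto simp: R'_def)
    then show ?thesis
      using False Suc.prems k addr by (simp add: T run_simps R'_def)
  qed
qed

text \<open>A round costs 12 instructions; \<open>15 * n + 11\<close> is 2 for leaving the loop plus
  \<open>7 * n + 8 * n + 9\<close> for the search from \<open>k = 0\<close>.\<close>

lemma run_count:
  assumes "R 0 = n" "R 1 = i" "R 2 = (\<Sum>v<i. \<sigma> v div n)" "R 3 = 1" "R 8 = 0" "R 9 = 0"
    and "i \<le> n" "(\<Sum>v<i. \<sigma> v div n) < n"
    and "\<And>v. v < n \<Longrightarrow> M v = \<sigma> v"
    and "\<And>r. r < n \<Longrightarrow> M (n + r) = card {v \<in> {..<i}. \<sigma> v mod n = r}"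
    and "12 * (n - i) + 15 * n + 11 \<le> T"
  shows "run T 1 R M"
  using assms
proof (induction "n - i" arbitrary: i R M T)
  case 0
  then have i: "i = n" by simp
  have [simp]: "arith w ADD n n = 2 * n"
    using addressable by (simp add: arith_def)
  have "2 \<le> T" using 0 by simp
  then obtain T' where T: "T = 2 + T'" by (auto dest: le_Suc_ex)
  have "run T' 17 (R(6 := 2 * n)) M"
    using 0 i T by (intro run_search) (auto simp: clique_firings_def)
  then show ?case
    using 0 i by (simp add: T run_simps)
next
  case (Suc m)
  have i: "i < n" "i < S" using Suc space by auto
  define q where "q = \<sigma> i div n"
  define r where "r = \<sigma> i mod n"
  have r: "r < n" "n + r < S" 
  proof -
    show "r < n" using n_pos by (simp add: r_def)
    then show "n + r < S" using space by linarith
  qed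
  have fin: "n - i = Suc m" "m = n - Suc i" using Suc by auto
  \<comment> \<open>A partial quotient sum of at least \<open>n\<close> forces
    \<open>firings (Suc k) \<ge> firings 0 \<ge> n > k\<close>.\<close>
  have reject: "k < firings (Suc k)" if "n \<le> (\<Sum>v<Suc i. \<sigma> v div n)" "k < n" for k
  proof -
    have "(\<Sum>v<Suc i. \<sigma> v div n) \<le> firings 0"
      using i by (auto simp: clique_firings_def intro!: sum_mono2 simp del: sum.lessThan_Suc)
    also have "\<dots> \<le> firings (Suc k)" by (rule clique_firings_mono) simp
    finally show ?thesis using that by simp
  qed
  have "q < 2 ^ w" using chips[OF i(1)] by (simp add: q_def le_less_trans[OF div_le_dividend])
  then have [simp]: "arith w DIV (\<sigma> i) n = q"
    by (simp add: arith_def q_def)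
  show ?case
  proof (cases "q < n")
    case False
    have "5 \<le> T" using Suc.prems by simp
    then obtain T' where T: "T = 5 + T'" by (auto dest: le_Suc_ex)
    have "run T' 14 R' M" for R'
      using False Suc.prems T by (intro run_reject reject) (auto simp: q_def)
    then show ?thesis
      using False Suc.prems i by (simp add: T run_simps)
  next
    case True
    let ?s = "\<Sum>v<Suc i. \<sigma> v div n"
    \<comment> \<open>Testing \<open>q < n\<close> first keeps this sum below \<open>2 * n\<close>,
      so the addition is exact even if the result is then rejected.\<close>
    have [simp]: "arith w ADD (\<Sum>v<i. \<sigma> v div n) q = ?s"
      using True Suc.prems by (simp add: arith_def mod_word q_def)
    have [simp]: "arith w MOD (\<sigma> i) n = r" "arith w ADD r n = n + r" "arith w ADD i (Suc 0) = Suc i"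
      using r i by (simp_all add: arith_def mod_word flip: r_def)
    have card: "card {v \<in> {..<Suc i}. \<sigma> v mod n = r'} =
        (if r' = r then Suc (M (n + r)) else M (n + r'))" if "r' < n" for r'
    proof -
      have "{v \<in> {..<Suc i}. \<sigma> v mod n = r'} =
        (if r' = r then insert i else id) {v \<in> {..<i}. \<sigma> v mod n = r'}"
        by (auto simp: r_def less_Suc_eq)
      then show ?thesis by (simp add: Suc.prems(10)[OF that] Suc.prems(10)[OF r(1)])
    qed
    have "M (n + r) \<le> card {..<i}"
      unfolding Suc.prems(10)[OF r(1)] by (intro card_mono) auto
    then have [simp]: "arith w ADD (M (n + r)) (Suc 0) = Suc (M (n + r))"
      using i by (simp add: arith_def mod_word)
    define R' where "R' = R(4 := \<sigma> i, 5 := q, 2 := ?s, 6 := n + r, 7 := Suc (M (n + r)), 1 := Suc i)"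
    define M' where "M' = M(n + r := Suc (M (n + r)))"
    have "12 \<le> T" using Suc.prems fin by simp
    then obtain T' where T: "T = 12 + T'" by (auto dest: le_Suc_ex)
    \<comment> \<open>Both outcomes of the test leave the same registers and memory, so one
      execution of the loop body serves both.\<close>
    have "run T' (if ?s < n then 1 else 14) R' M'"
    proof (cases "?s < n")
      case True
      have "run T' 1 R' M'"
        using True Suc.prems i card T by (intro Suc.hyps(1)) (auto simp: R'_def M'_def fin)
      then show ?thesis using True by simp
    next
      case False
      have "run T' 14 R' M'"
        using False Suc.prems T by (intro run_reject reject) auto
      then show ?thesis using False by simp
    qed
    then show ?thesis
      using True Suc.prems(1-9) i r
      by (simp add: T run_simps R'_def M'_def fun_upd_twist del: sum.lessThan_Suc split: if_splits)
  qed
qed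

lemma clique_program_solves:
  "runs_to w clique_program S (40 * n) (input_state n \<sigma>) solved"
proof -
  let ?R = "(\<lambda>r. if r = 0 then n else 0)(3 := 1) :: nat \<Rightarrow> nat"
  \<comment> \<open>One initial load plus \<open>12 * n + 15 * n + 11\<close> stays below
    \<open>40 * n\<close> for \<open>n \<ge> 1\<close>.\<close>
  obtain T where T: "40 * n = Suc T" "27 * n + 11 \<le> T"
    using n_pos by (cases "40 * n") auto
  \<comment> \<open>Cells from \<open>n\<close> on start at 0, the residue counts of the empty
    prefix.\<close>
  have "run T 1 ?R (\<lambda>a. if a < n then \<sigma> a else 0)"
    using n_pos T by (intro run_count) auto
  then show ?thesis
    unfolding T input_state_def by (simp add: run_simps)
qed

end

theorem theorem6p7:
  shows "\<exists>(P :: program) (c :: nat). c \<ge> 1 \<and>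
    (\<forall>w :: nat \<Rightarrow> nat. logarithmic_word_length c w \<longrightarrow>
      (\<exists>C :: nat. \<forall>(n :: nat) (G :: nat pair_pre_digraph) (\<sigma> :: nat config).
         n \<ge> 1 \<longrightarrow> complete_digraph n (with_proj G) \<longrightarrow> verts (with_proj G) = {..<n} \<longrightarrow>
         (\<forall>v\<in>verts (with_proj G). \<sigma> v < 2 ^ w n) \<longrightarrow>
         (\<exists>s. halts_within (w n) P (input_state n \<sigma>) (C * n) (C * n) s \<and>
              correct_output (with_proj G) \<sigma> s)))"
\<comment> \<open>The 2 makes both blocks of \<open>n\<close> cells addressable.\<close>
proof (rule exI[of _ clique_program], rule exI[of _ 2], intro conjI allI impI)
  fix w :: "nat \<Rightarrow> nat"
  assume w: "logarithmic_word_length 2 w"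
  show "\<exists>C. \<forall>n (G :: nat pair_pre_digraph) \<sigma>. n \<ge> 1 \<longrightarrow> complete_digraph n (with_proj G) \<longrightarrow>
    verts (with_proj G) = {..<n} \<longrightarrow> (\<forall>v\<in>verts (with_proj G). \<sigma> v < 2 ^ w n) \<longrightarrow>
    (\<exists>s. halts_within (w n) clique_program (input_state n \<sigma>) (C * n) (C * n) s \<and>
      correct_output (with_proj G) \<sigma> s)"
  proof (rule exI[of _ 40], intro allI impI)
    fix n :: nat and G :: "nat pair_pre_digraph" and \<sigma> :: "nat config"
    assume n: "n \<ge> 1" and G: "complete_digraph n (with_proj G)"
      and V: "verts (with_proj G) = {..<n}" and chips: "\<forall>v\<in>verts (with_proj G). \<sigma> v < 2 ^ w n"
    interpret clique_run n "w n" "40 * n" \<sigma>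
      using w n V chips by unfold_locales (auto simp: logarithmic_word_length_def)
    obtain s where s: "halts_within (w n) clique_program (input_state n \<sigma>) (40 * n) (40 * n) s" "solved s"
      using runs_to_halts_within[OF clique_program_solves] by blast
    have "terminates (with_proj G) \<sigma> \<longleftrightarrow> (\<exists>k<n. firings (Suc k) \<le> k)"
      using clique_terminates_iff[OF G] n V by simp
    moreover have "\<tau> v = (\<sigma> v + (LEAST k. firings (Suc k) \<le> k)) mod n"
      if "terminal_config_of (with_proj G) \<sigma> \<tau>" "v < n" for \<tau> v
      using clique_terminal_config(2)[OF G _ that(1), of v] n V that by simp
    ultimately have "correct_output (with_proj G) \<sigma> s"
      using s(2) V by (auto simp: correct_output_def solved_def terminates_def split: if_splits)
    then show "\<exists>s. halts_within (w n) clique_program (input_state n \<sigma>) (40 * n) (40 * n) s \<and>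
        correct_output (with_proj G) \<sigma> s"
      using s(1) by blast
  qed
qed simp

end
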